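(* Let $\delta,\beta\in(0,1)$ and let $R^{(0)},R^{(1)},R^{(2)},\ldots$ be i.i.d. real random variables with distribution $\mathbb{P}$ and cumulative distribution function $F$. For each $K\ge 1$ let $r_K(\beta)>0$ be a (deterministic) radius satisfying $\mathbb{P}^K\bigl(W_\infty(\widehat{\mathbb{P}}_K,\mathbb{P})\le r_K(\beta)\bigr)\ge 1-\beta$, and let $$\bar\alpha_{\mathrm{DRO}}:=\mathrm{Quantile}_{1-\delta}(R^{(1)},\ldots,R^{(K)})+r_K(\beta).$$ Let $\alpha:=\inf\{a\in\mathbb{R}:F(a)\ge1-\delta\}$ be the $(1-\delta)$-quantile of $R^{(0)}$. Suppose that $F$ is continuous and strictly increasing in a neighborhood of $\alpha$ and that $r_K(\beta)\to0$ as $K\to\infty$. Then: (i) $\bar\alpha_{\mathrm{DRO}}\to\alpha$ almost surely as $K\to\infty$. (ii) For any $t\in\mathbb{R}$, $$\mathbb{P}^K\bigl(\bar\alpha_{\mathrm{DRO}}\le t\bigr)=\sum_{i=m_{\mathrm{DRO}}}^{K}\binom{K}{i}F(u)^i\bigl(1-F(u)\bigr)^{K-i},\qquad u:=t-r_K(\beta),\quad m_{\mathrm{DRO}}:=\lceil K(1-\delta)\rceil.$$ (iii) If, furthermore, $F$ is differentiable at $\alpha$ with density $f(\alpha)=F'(\alpha)>0$ and $\sqrt{K}\,r_K(\beta)\to c_\beta$ for some constant $c_\beta\ge0$, then as $K\to\infty$ $$\sqrt{K}\,(\bar\alpha_{\mathrm{DRO}}-\alpha)\xrightarrow{d}\frac{\sqrt{\delta(1-\delta)}}{f(\alpha)}N(0,1)+c_\beta,$$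 where $\xrightarrow{d}$ denotes convergence in distribution and $N(0,1)$ a standard normal random variable. The condition that $\sqrt{K}\,r_K(\beta)$ converges to a nonnegative constant holds, for example, for the choice $r_K(\beta)=\frac1m\sqrt{\frac{\ln(2/\beta)}{2K}}$, used when $\mathbb{P}$ is supported on an interval $[a,b]$ and has a density bounded below by $m>0$ on $[a,b]$.
   Context: $\mathbb{P}^K=\mathbb{P}^{\otimes K}$ denotes probability over the i.i.d. sample $R^{(1)},\ldots,R^{(K)}$. For values $a_1,\ldots,a_n$ and $p\in(0,1)$, $\mathrm{Quantile}_p(a_1,\ldots,a_n)$ is the $\lceil np\rceil$-th smallest of them. $\widehat{\mathbb{P}}_K=\frac1K\sum_{i=1}^K\delta_{R^{(i)}}$ is the empirical distribution. $W_\infty(\mathbb{P}_1,\mathbb{P}_2):=\inf_{\pi\in\Gamma(\mathbb{P}_1,\mathbb{P}_2)}\sup_{(x_1,x_2)\in\operatorname{supp}(\pi)}|x_1-x_2|$, where $\Gamma(\mathbb{P}_1,\mathbb{P}_2)$ is the set of couplings of $\mathbb{P}_1$ and $\mathbb{P}_2$. *)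

theory Defs
  imports "HOL-Probability.Probability"
begin

definition measure_support :: "'a::topological_space measure \<Rightarrow> 'a set" where
  "measure_support \<mu> = {x. \<forall>U. open U \<and> x \<in> U \<longrightarrow> emeasure \<mu> U > 0}"

definition couplings :: "real measure \<Rightarrow> real measure \<Rightarrow> (real \<times> real) measure set" where
  "couplings P Q = {\<pi>. prob_space \<pi> \<and> sets \<pi> = sets borel \<and>
     distr \<pi> borel fst = P \<and> distr \<pi> borel snd = Q}"

(* ennreal-valued, because the supremum over the support may be infinite. *)
definition W_inf :: "real measure \<Rightarrow> real measure \<Rightarrow> ennreal" where
  "W_inf P Q = (INF \<pi> \<in> couplings P Q. SUP (x, y) \<in> measure_support \<pi>. ennreal \<bar>x - y\<bar>)"

(* The average of the Dirac measures at x 1, ..., x K. *)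
definition empirical_measure :: "nat \<Rightarrow> (nat \<Rightarrow> real) \<Rightarrow> real measure" where
  "empirical_measure K x = measure_of UNIV (sets borel)
     (\<lambda>A. ennreal (1 / real K) * (\<Sum>i\<in>{1..K}. emeasure (return borel (x i)) A))"

(* measure_of yields the null measure if its set function is not countably additive;
   the next lemma excludes this. *)
lemma emeasure_empirical_measure:
  assumes "A \<in> sets borel"
  shows "emeasure (empirical_measure K x) A =
    ennreal (1 / real K) * (\<Sum>i\<in>{1..K}. emeasure (return borel (x i)) A)"
proof (rule emeasure_measure_of[OF empirical_measure_def])
  show "sets borel \<subseteq> Pow (UNIV :: real set)" by simp
  show "A \<in> sets (empirical_measure K x)"
    using assms sets.sigma_sets_eq[of "borel :: real measure"] by (simp add: empirical_measure_def)
  show "positive (sets (empirical_measure K x))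
      (\<lambda>A. ennreal (1 / real K) * (\<Sum>i\<in>{1..K}. emeasure (return borel (x i)) A))"
    by (simp add: positive_def)
  show "countably_additive (sets (empirical_measure K x))
      (\<lambda>A. ennreal (1 / real K) * (\<Sum>i\<in>{1..K}. emeasure (return borel (x i)) A))"
  proof (rule countably_additiveI)
    fix B :: "nat \<Rightarrow> real set"
    assume B: "range B \<subseteq> sets (empirical_measure K x)" "disjoint_family B"
    have "range B \<subseteq> sets borel"
      using B(1) sets.sigma_sets_eq[of "borel :: real measure"] by (simp add: empirical_measure_def)
    then have "(\<Sum>n. emeasure (return borel (x i)) (B n)) = emeasure (return borel (x i)) (\<Union>n. B n)" for i
      using B(2) by (intro suminf_emeasure) auto
    then show "(\<Sum>n. ennreal (1 / real K) * (\<Sum>i\<in>{1..K}. emeasure (return borel (x i)) (B n)))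
      = ennreal (1 / real K) * (\<Sum>i\<in>{1..K}. emeasure (return borel (x i)) (\<Union>n. B n))"
      by (subst ennreal_suminf_cmult, subst suminf_sum) (auto intro: summableI)
  qed
qed

(* The \<lceil>n p\<rceil>-th smallest of the n values in xs; list indices start at 0. *)
definition sample_quantile :: "real \<Rightarrow> real list \<Rightarrow> real" where
  "sample_quantile p xs = sort xs ! (nat \<lceil>real (length xs) * p\<rceil> - 1)"

(* \<rho> is the radius r_K(\<beta>). Only the coordinates x 1, ..., x K of the sample are used. *)
definition alpha_DRO :: "real \<Rightarrow> real \<Rightarrow> nat \<Rightarrow> (nat \<Rightarrow> real) \<Rightarrow> real" where
  "alpha_DRO \<delta> \<rho> K x = sample_quantile (1 - \<delta>) (map x [1..<Suc K]) + \<rho>"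

(* The K-fold product of P, on functions indexed by {1..K}. *)
definition sample_measure :: "nat \<Rightarrow> real measure \<Rightarrow> (nat \<Rightarrow> real) measure" where
  "sample_measure K P = PiM {1..K} (\<lambda>_. P)"

end

theory Submission
  imports Defs
begin

text \<open>
  Everything rests on a single equivalence: the \<open>\<lceil>K (1 - \<delta>)\<rceil>\<close>-th smallest of \<open>K\<close> values is at most
  \<open>u\<close> exactly when at least \<open>K (1 - \<delta>)\<close> of them are at most \<open>u\<close> (lemmas
  \<open>alpha_DRO_le_iff_card\<close> and \<open>alpha_DRO_le_iff_sum\<close>). The distribution function of the empirical
  quantile is thus the upper tail of a sum of \<open>K\<close> independent Bernoulli variables with success
  probability \<open>F u\<close>, and each of the three claims is a classical fact about such sums.

  The finite-sample law is the binomial tail (\<open>measure_PiM_card_ge\<close>).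

  For consistency, \<open>F (\<alpha> - \<eta>) < 1 - \<delta> < F (\<alpha> + \<eta>)\<close> for every \<open>\<eta> > 0\<close>, and the empirical
  frequencies of the events \<open>R i \<le> \<alpha> \<plusminus> \<eta>\<close> converge almost surely to these two values by a strong
  law, which for bounded variables follows from Hoeffding's inequality and the Borel--Cantelli
  lemma (\<open>strong_law_bounded\<close>). This eventually traps the quantile between \<open>\<alpha> - \<eta>\<close> and \<open>\<alpha> + \<eta>\<close>.

  For the limit law, the event \<open>sqrt K * (alpha_DRO - \<alpha>) \<le> z\<close> says that the normalised sum of the
  centred variables \<open>F u\<^sub>K - indicator {..u\<^sub>K} (R i)\<close>, with the threshold
  \<open>u\<^sub>K = \<alpha> + z / sqrt K - r\<^sub>K\<close>, is at most \<open>sqrt K * (F u\<^sub>K - (1 - \<delta>))\<close>. The summands change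
  with \<open>K\<close>, so a central limit theorem for arrays is needed (\<open>clt_bounded_array\<close>); it gives the
  limit \<open>N(0, \<delta> (1 - \<delta>))\<close>. The bound on the right tends to \<open>f * (z - c)\<close> by
  differentiability of \<open>F\<close> at \<open>\<alpha>\<close>, and solving \<open>sqrt (\<delta> (1 - \<delta>)) Z \<le> f (z - c)\<close> for \<open>z\<close>
  yields the stated limit.
\<close>

section \<open>Empirical quantiles and counts\<close>

text \<open>
  The entries that are at most \<open>t\<close> form an initial segment of a sorted list, so their number decides
  whether the entry at a given position is one of them.
\<close>

lemma sorted_nth_le_iff:
  fixes t :: "'a::linorder"
  assumes "sorted ys" "k < length ys"
  shows "ys ! k \<le> t \<longleftrightarrow> k < length (filter (\<lambda>y. y \<le> t) ys)"
  using assms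
proof (induction ys arbitrary: k)
  case (Cons a ys)
  show ?case
  proof (cases "a \<le> t")
    case True
    then show ?thesis using Cons by (cases k) auto
  next
    case False
    then have "\<forall>y\<in>set (a # ys). \<not> y \<le> t" using Cons.prems(1) by auto
    then have "filter (\<lambda>y. y \<le> t) (a # ys) = []" "\<not> (a # ys) ! k \<le> t"
      using nth_mem[OF Cons.prems(2)] by (auto simp: filter_empty_conv simp del: nth_mem)
    then show ?thesis by simp
  qed
qed simp

lemma alpha_DRO_le_iff_card:
  assumes "0 < \<delta>" "\<delta> < 1" "K \<ge> 1"
  shows "alpha_DRO \<delta> \<rho> K x \<le> t \<longleftrightarrow>
    nat \<lceil>real K * (1 - \<delta>)\<rceil> \<le> card {i \<in> {1..K}. x i \<in> {..t - \<rho>}}"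
proof -
  define m where "m = nat \<lceil>real K * (1 - \<delta>)\<rceil>"
  define xs where "xs = map x [1..<Suc K]"
  have "0 < real K * (1 - \<delta>)" "real K * (1 - \<delta>) \<le> real K"
    using assms by (auto simp: mult_le_cancel_left1)
  then have m: "1 \<le> m" "m \<le> K" unfolding m_def by linarith+
  have "alpha_DRO \<delta> \<rho> K x \<le> t \<longleftrightarrow> sort xs ! (m - 1) \<le> t - \<rho>"
    by (simp add: alpha_DRO_def sample_quantile_def xs_def m_def algebra_simps del: upt_Suc)
  also have "\<dots> \<longleftrightarrow> m - 1 < length (filter (\<lambda>y. y \<le> t - \<rho>) (sort xs))"
    using m by (intro sorted_nth_le_iff) (auto simp: xs_def)
  also have "length (filter (\<lambda>y. y \<le> t - \<rho>) (sort xs)) = length (filter (\<lambda>y. y \<le> t - \<rho>) xs)"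
    by (simp add: filter_sort)
  also have "\<dots> = length (filter (\<lambda>i. x i \<le> t - \<rho>) [1..<Suc K])"
    unfolding xs_def by (simp add: filter_map comp_def del: upt_Suc)
  also have "\<dots> = card ({i. x i \<le> t - \<rho>} \<inter> set [1..<Suc K])"
    by (rule distinct_length_filter) simp
  also have "{i. x i \<le> t - \<rho>} \<inter> set [1..<Suc K] = {i \<in> {1..K}. x i \<in> {..t - \<rho>}}" by auto
  finally show ?thesis using m unfolding m_def[symmetric] by linarith
qed

text \<open>Since a count is an integer, the rounding in the rank disappears from the condition.\<close>

lemma alpha_DRO_le_iff_sum:
  assumes "0 < \<delta>" "\<delta> < 1" "K \<ge> 1"
  shows "alpha_DRO \<delta> \<rho> K x \<le> t \<longleftrightarrow>
    real K * (1 - \<delta>) \<le> (\<Sum>i=1..K. indicator {..t - \<rho>} (x i))"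
proof -
  have "(\<Sum>i=1..K. indicator {..t - \<rho>} (x i) :: real) = real (card {i \<in> {1..K}. x i \<in> {..t - \<rho>}})"
    by (simp add: indicator_def sum.If_cases Int_def)
  then show ?thesis
    unfolding alpha_DRO_le_iff_card[OF assms] by (simp add: nat_le_iff ceiling_le_iff)
qed

lemma alpha_DRO_shift: "alpha_DRO \<delta> \<rho> K x = alpha_DRO \<delta> 0 K x + \<rho>"
  by (simp add: alpha_DRO_def)

section \<open>The binomial tail\<close>

text \<open>
  Splitting the sample space according to the set \<open>S\<close> of coordinates that hit \<open>A\<close> gives disjoint
  boxes whose measure depends only on the size of \<open>S\<close>.
\<close>

lemma measure_PiM_card_ge:
  fixes I :: "'i set"
  assumes "prob_space P" and I: "finite I" and A: "A \<in> sets P"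
  shows "measure (PiM I (\<lambda>_. P)) {x \<in> space (PiM I (\<lambda>_. P)). m \<le> card {i \<in> I. x i \<in> A}} =
    (\<Sum>k = m..card I. real (card I choose k) * measure P A ^ k * (1 - measure P A) ^ (card I - k))"
proof -
  interpret P: prob_space P by fact
  interpret PP: finite_product_prob_space "\<lambda>_. P" I by standard (fact I)
  let ?N = "PiM I (\<lambda>_. P)"
  define T where "T k = {S. S \<subseteq> I \<and> card S = k}" for k
  define box where "box S = Pi\<^sub>E I (\<lambda>i. if i \<in> S then A else space P - A)" for S
  have finT: "finite (T k)" for k
    unfolding T_def using I by simp
  have sets_box: "box S \<in> sets ?N" for S
    unfolding box_def using A I by (intro sets_PiM_I_finite) auto
  have box: "measure ?N (box S) = measure P A ^ k * (1 - measure P A) ^ (card I - k)"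
    if "S \<in> T k" for S k
  proof -
    have S: "S \<subseteq> I" "card S = k" "finite S"
      using that I by (auto simp: T_def intro: finite_subset)
    have "measure ?N (box S) = (\<Prod>i\<in>I. measure P (if i \<in> S then A else space P - A))"
      unfolding box_def using A I by (intro PP.prob_times) auto
    also have "\<dots> = (\<Prod>i\<in>I. if i \<in> S then measure P A else 1 - measure P A)"
      using A by (intro prod.cong) (auto simp: P.prob_compl)
    also have "\<dots> = measure P A ^ card (I \<inter> S) * (1 - measure P A) ^ card (I - S)"
      using I by (simp add: prod.If_cases Diff_eq)
    also have "I \<inter> S = S" using S by auto
    finally show ?thesis using S I by (simp add: card_Diff_subset)
  qed
  have hits: "{i \<in> I. x i \<in> A} = S" if "x \<in> box S" "S \<subseteq> I" for x S
    using that by (auto simp: box_def PiE_iff split: if_splits)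
  have "{x \<in> space ?N. m \<le> card {i \<in> I. x i \<in> A}} = (\<Union>S\<in>(\<Union>k\<in>{m..card I}. T k). box S)"
    (is "?L = ?R")
  proof (intro set_eqI iffI)
    fix x assume x: "x \<in> ?L"
    let ?S = "{i \<in> I. x i \<in> A}"
    have "x \<in> box ?S" using x by (auto simp: box_def space_PiM PiE_iff)
    moreover have "?S \<in> T (card ?S)" "card ?S \<in> {m..card I}"
      using x I by (auto simp: T_def intro: card_mono)
    ultimately show "x \<in> ?R" by blast
  next
    fix x assume "x \<in> ?R"
    then obtain k S where S: "k \<in> {m..card I}" "S \<in> T k" "x \<in> box S" by blast
    have "x \<in> space ?N" using sets.sets_into_space[OF sets_box] S(3) by blast
    then show "x \<in> ?L" using S hits[OF S(3)] by (auto simp: T_def)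
  qed
  then have "measure ?N ?L = measure ?N ?R" by simp
  also have "\<dots> = (\<Sum>S\<in>(\<Union>k\<in>{m..card I}. T k). measure ?N (box S))"
  proof (rule measure_finite_Union)
    show "disjoint_family_on box (\<Union>k\<in>{m..card I}. T k)"
      unfolding disjoint_family_on_def
    proof (intro ballI impI)
      fix S S' assume S: "S \<in> (\<Union>k\<in>{m..card I}. T k)" "S' \<in> (\<Union>k\<in>{m..card I}. T k)" "S \<noteq> S'"
      then have "S \<subseteq> I" "S' \<subseteq> I" by (auto simp: T_def)
      then show "box S \<inter> box S' = {}" using hits[of _ S] hits[of _ S'] S(3) by blast
    qed
  qed (use finT sets_box in auto)
  also have "\<dots> = (\<Sum>k = m..card I. \<Sum>S\<in>T k. measure ?N (box S))"
    using finT by (intro sum.UNION_disjoint) (auto simp: T_def)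
  also have "\<dots> = (\<Sum>k = m..card I.
      real (card I choose k) * measure P A ^ k * (1 - measure P A) ^ (card I - k))"
    using n_subsets[OF I] by (intro sum.cong) (auto simp: box T_def[symmetric])
  finally show ?thesis .
qed

section \<open>A strong law of large numbers for bounded variables\<close>

text \<open>
  By Hoeffding's inequality the probability of a deviation \<open>e\<close> of the mean decays exponentially in
  the sample size, hence is summable, and almost surely only finitely many such deviations occur.
\<close>

lemma (in prob_space) strong_law_bounded:
  fixes X :: "nat \<Rightarrow> 'a \<Rightarrow> real"
  assumes indep: "indep_vars (\<lambda>_. borel) X UNIV"
    and bounds: "\<And>i \<omega>. \<omega> \<in> space M \<Longrightarrow> X i \<omega> \<in> {0..1}"
    and mean: "\<And>i. expectation (X i) = \<mu>"
  shows "AE \<omega> in M. (\<lambda>n. (\<Sum>i=1..n. X i \<omega>) / real n) \<longlonglongrightarrow> \<mu>"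
proof -
  have [measurable]: "random_variable borel (X i)" for i
    using indep by (auto simp: indep_vars_def2)
  have deviation: "AE \<omega> in M. eventually (\<lambda>n. \<bar>(\<Sum>i=1..n. X i \<omega>) / real n - \<mu>\<bar> < e) sequentially"
    if e: "e > 0" for e
  proof -
    define B where "B n = {\<omega> \<in> space M. \<bar>(\<Sum>i=1..n. X i \<omega>) - real n * \<mu>\<bar> \<ge> real n * e}" for n
    have [measurable]: "B n \<in> sets M" for n unfolding B_def by measurable
    have prob_B: "prob (B n) \<le> 2 * exp (-2 * e\<^sup>2) ^ n" for n
    proof (cases "n = 0")
      case True
      have "prob (B n) \<le> 1" by simp
      also have "1 \<le> 2 * exp (-2 * e\<^sup>2) ^ n" using True by simp
      finally show ?thesis .
    next
      case False
      interpret Hoeffding_ineq M "{1..n}" X "\<lambda>_. 0" "\<lambda>_. 1" "\<Sum>i\<in>{1..n}. expectation (X i)"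
        by unfold_locales (use bounds in \<open>auto intro: indep_vars_subset[OF indep]\<close>)
      have "prob (B n) \<le> 2 * exp (-2 * (real n * e)\<^sup>2 / real n)"
        using Hoeffding_ineq_abs_ge[of "real n * e"] e False by (simp add: B_def mean)
      also have "-2 * (real n * e)\<^sup>2 / real n = real n * (-2 * e\<^sup>2)"
        using False by (simp add: power2_eq_square)
      finally show ?thesis by (simp only: exp_of_nat_mult)
    qed
    have "summable (\<lambda>n. 2 * exp (-2 * e\<^sup>2) ^ n)"
      using e by (intro summable_mult summable_geometric) auto
    then have "summable (\<lambda>n. prob (B n))"
      by (rule summable_comparison_test'[where N = 0]) (use prob_B in auto)
    then have "AE \<omega> in M. eventually (\<lambda>n. \<omega> \<in> space M - B n) sequentially"
      by (intro borel_cantelli_AE1) (auto simp: less_top[symmetric])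
    then show ?thesis
    proof eventually_elim
      case (elim \<omega>)
      show ?case using elim eventually_gt_at_top[of 0]
      proof eventually_elim
        case (elim n)
        have "(\<Sum>i=1..n. X i \<omega>) / real n - \<mu> = ((\<Sum>i=1..n. X i \<omega>) - real n * \<mu>) / real n"
          using elim by (simp add: field_simps)
        then show ?case using elim by (auto simp: B_def abs_divide field_simps)
      qed
    qed
  qed
  have "AE \<omega> in M. \<forall>j::nat.
      eventually (\<lambda>n. \<bar>(\<Sum>i=1..n. X i \<omega>) / real n - \<mu>\<bar> < 1 / real (Suc j)) sequentially"
    unfolding AE_all_countable by (intro allI deviation) simp
  then show ?thesis
  proof eventually_elim
    case (elim \<omega>)
    show ?case
    proof (rule tendstoI)
      fix e :: real assume "e > 0"
      then obtain j where "1 / real (Suc j) < e" using nat_approx_posE by blast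
      with elim[rule_format, of j]
      show "eventually (\<lambda>n. dist ((\<Sum>i=1..n. X i \<omega>) / real n) \<mu> < e) sequentially"
        by (auto simp: dist_real_def elim!: eventually_mono)
    qed
  qed
qed

section \<open>A central limit theorem for bounded arrays\<close>

lemma exp_minus_approx:
  fixes x :: real
  assumes "x \<ge> 0"
  shows "\<bar>exp (- x) - (1 - x)\<bar> \<le> x\<^sup>2"
proof -
  have "exp (- x) \<le> 1 / (1 + x)"
    using exp_ge_add_one_self[of x] assms by (simp add: exp_minus field_simps)
  also have "1 \<le> (1 - x + x\<^sup>2) * (1 + x)"
    using assms by (simp add: algebra_simps power2_eq_square)
  then have "1 / (1 + x) \<le> 1 - x + x\<^sup>2"
    using assms by (simp add: pos_divide_le_eq)
  finally show ?thesis using exp_ge_add_one_self[of "- x"] by simp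
qed

text \<open>
  Second-order expansion of the characteristic function of a bounded centred variable; the error
  estimate is explicit and so holds uniformly over all such variables, which is what makes it
  applicable to arrays.
\<close>

lemma (in prob_space) char_approx_gauss:
  fixes X :: "'a \<Rightarrow> real"
  assumes [measurable]: "random_variable borel X"
    and bound: "\<And>\<omega>. \<omega> \<in> space M \<Longrightarrow> \<bar>X \<omega>\<bar> \<le> 1"
    and mean: "expectation X = 0" and var: "expectation (\<lambda>\<omega>. (X \<omega>)\<^sup>2) = v"
    and \<tau>: "\<tau> \<ge> 0"
  shows "cmod (char (distr M borel X) s - of_real (exp (- (s\<^sup>2 * \<tau> / 2)))) \<le>
    \<bar>s\<bar> ^ 3 / 6 + s\<^sup>2 * \<bar>v - \<tau>\<bar> / 2 + (s\<^sup>2 * \<tau> / 2)\<^sup>2"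
proof -
  have int: "integrable M X" "integrable M (\<lambda>\<omega>. (X \<omega>)\<^sup>2)"
    using bound by (auto intro!: integrable_const_bound[where B = 1] AE_I2 simp: abs_square_le_1)
  have "expectation (\<lambda>\<omega>. min (6 * (X \<omega>)\<^sup>2) (\<bar>s\<bar> * \<bar>X \<omega>\<bar> ^ 3)) \<le> expectation (\<lambda>_. \<bar>s\<bar>)"
  proof (rule integral_mono)
    show "integrable M (\<lambda>\<omega>. min (6 * (X \<omega>)\<^sup>2) (\<bar>s\<bar> * \<bar>X \<omega>\<bar> ^ 3))"
    proof (rule integrable_const_bound[where B = 6], rule AE_I2)
      fix \<omega> assume "\<omega> \<in> space M"
      then have "(X \<omega>)\<^sup>2 \<le> 1" using bound by (simp add: abs_square_le_1)
      then have "min (6 * (X \<omega>)\<^sup>2) (\<bar>s\<bar> * \<bar>X \<omega>\<bar> ^ 3) \<le> 6" by (intro min.coboundedI1) simp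
      then show "norm (min (6 * (X \<omega>)\<^sup>2) (\<bar>s\<bar> * \<bar>X \<omega>\<bar> ^ 3)) \<le> 6" by (simp add: min_def)
    qed measurable
    show "min (6 * (X \<omega>)\<^sup>2) (\<bar>s\<bar> * \<bar>X \<omega>\<bar> ^ 3) \<le> \<bar>s\<bar>" if "\<omega> \<in> space M" for \<omega>
      using bound[OF that] by (intro min.coboundedI2) (simp add: mult_left_le power_le_one)
  qed simp
  then have moment: "expectation (\<lambda>\<omega>. min (6 * (X \<omega>)\<^sup>2) (\<bar>s\<bar> * \<bar>X \<omega>\<bar> ^ 3)) \<le> \<bar>s\<bar>"
    by (simp add: prob_space)
  have "cmod (char (distr M borel X) s - (1 - s\<^sup>2 * v / 2))
      \<le> s\<^sup>2 / 6 * expectation (\<lambda>\<omega>. min (6 * (X \<omega>)\<^sup>2) (\<bar>s\<bar> * \<bar>X \<omega>\<bar> ^ 3))"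
    using char_approx3'[OF _ int mean _ refl, of v s] var mean by simp
  also have "\<dots> \<le> s\<^sup>2 / 6 * \<bar>s\<bar>" by (intro mult_left_mono moment) simp
  also have "\<dots> = \<bar>s\<bar> ^ 3 / 6" by (simp add: power2_eq_square power3_eq_cube flip: abs_mult)
  finally have 1: "cmod (char (distr M borel X) s - of_real (1 - s\<^sup>2 * v / 2)) \<le> \<bar>s\<bar> ^ 3 / 6" by simp
  have "\<bar>(1 - s\<^sup>2 * v / 2) - (1 - s\<^sup>2 * \<tau> / 2)\<bar> = s\<^sup>2 * \<bar>v - \<tau>\<bar> / 2"
    by (simp add: abs_mult abs_minus_commute flip: right_diff_distrib diff_divide_distrib)
  moreover have "\<bar>exp (- (s\<^sup>2 * \<tau> / 2)) - (1 - s\<^sup>2 * \<tau> / 2)\<bar> \<le> (s\<^sup>2 * \<tau> / 2)\<^sup>2"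
    using \<tau> by (intro exp_minus_approx) simp
  ultimately have "\<bar>(1 - s\<^sup>2 * v / 2) - exp (- (s\<^sup>2 * \<tau> / 2))\<bar>
      \<le> s\<^sup>2 * \<bar>v - \<tau>\<bar> / 2 + (s\<^sup>2 * \<tau> / 2)\<^sup>2" by linarith
  then have 2: "cmod (of_real (1 - s\<^sup>2 * v / 2) - of_real (exp (- (s\<^sup>2 * \<tau> / 2))))
      \<le> s\<^sup>2 * \<bar>v - \<tau>\<bar> / 2 + (s\<^sup>2 * \<tau> / 2)\<^sup>2"
    by (simp only: norm_of_real flip: of_real_diff)
  show ?thesis using norm_diff_triangle_le[OF 1 2] by (simp add: add.assoc)
qed

text \<open>
  The law of the summands may change from row to row, which the classical theorem for a single i.i.d.
  sequence does not allow. Writing the Gaussian limit \<open>exp (- \<sigma>\<^sup>2 t\<^sup>2 / 2)\<close> as an \<open>n\<close>-th power reduces the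
  convergence of characteristic functions to \<open>n\<close> times the one-variable error, which vanishes.
\<close>

lemma (in prob_space) clt_bounded_array:
  fixes X :: "nat \<Rightarrow> nat \<Rightarrow> 'a \<Rightarrow> real"
  assumes indep: "\<And>n. indep_vars (\<lambda>_. borel) (X n) {1..n}"
    and bound: "\<And>n i \<omega>. i \<in> {1..n} \<Longrightarrow> \<omega> \<in> space M \<Longrightarrow> \<bar>X n i \<omega>\<bar> \<le> 1"
    and mean: "\<And>n i. i \<in> {1..n} \<Longrightarrow> expectation (X n i) = 0"
    and var: "\<And>n i. i \<in> {1..n} \<Longrightarrow> expectation (\<lambda>\<omega>. (X n i \<omega>)\<^sup>2) = v n"
    and lim: "v \<longlonglongrightarrow> \<sigma>\<^sup>2"
  shows "weak_conv_m (\<lambda>n. distr M borel (\<lambda>\<omega>. (\<Sum>i=1..n. X n i \<omega>) / sqrt (real n)))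
    (distr std_normal_distribution borel (\<lambda>z. \<sigma> * z))"
proof (rule levy_continuity)
  have rv[measurable]: "random_variable borel (X n i)" if "i \<in> {1..n}" for n i
    using indep[of n] that by (auto simp: indep_vars_def2)
  show "real_distribution (distr M borel (\<lambda>\<omega>. (\<Sum>i=1..n. X n i \<omega>) / sqrt (real n)))" for n
    by (intro real_distribution_distr borel_measurable_divide borel_measurable_sum rv) auto
  interpret N: real_distribution std_normal_distribution by (rule real_dist_normal_dist)
  show "real_distribution (distr std_normal_distribution borel (\<lambda>z. \<sigma> * z))"
    by (intro N.real_distribution_distr) simp
  fix t :: real
  define err where "err n = \<bar>t\<bar> ^ 3 / 6 * (1 / sqrt (real n)) + t\<^sup>2 / 2 * \<bar>v n - \<sigma>\<^sup>2\<bar>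
    + (t\<^sup>2 * \<sigma>\<^sup>2 / 2)\<^sup>2 * (1 / real n)" for n
  have "char (distr std_normal_distribution borel (\<lambda>z. \<sigma> * z)) t = char std_normal_distribution (t * \<sigma>)"
    unfolding char_def by (subst integral_distr) (simp_all add: mult.assoc)
  also have "\<dots> = of_real (exp (- (t\<^sup>2 * \<sigma>\<^sup>2 / 2)))"
    by (simp add: char_std_normal_distribution power_mult_distrib)
  finally have limit: "char (distr std_normal_distribution borel (\<lambda>z. \<sigma> * z)) t
    = of_real (exp (- (t\<^sup>2 * \<sigma>\<^sup>2 / 2)))" .
  have bound_err: "cmod (char (distr M borel (\<lambda>\<omega>. (\<Sum>i=1..n. X n i \<omega>) / sqrt (real n))) t
      - of_real (exp (- (t\<^sup>2 * \<sigma>\<^sup>2 / 2)))) \<le> err n" if n: "n \<ge> 1" for n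
  proof -
    define s where "s = t / sqrt (real n)"
    define g where "g = exp (- (s\<^sup>2 * \<sigma>\<^sup>2 / 2))"
    have s2: "s\<^sup>2 = t\<^sup>2 / real n" using n by (simp add: s_def power_divide)
    define \<psi> where "\<psi> i = char (distr M borel (X n i)) s" for i
    have scale: "char (distr M borel (\<lambda>\<omega>. X n i \<omega> / sqrt (real n))) t = \<psi> i" if "i \<in> {1..n}" for i
      using rv[OF that] by (simp add: char_def integral_distr \<psi>_def s_def)
    have "char (distr M borel (\<lambda>\<omega>. (\<Sum>i=1..n. X n i \<omega>) / sqrt (real n))) t
        = char (distr M borel (\<lambda>\<omega>. \<Sum>i=1..n. X n i \<omega> / sqrt (real n))) t"
      by (simp add: sum_divide_distrib)
    also have "\<dots> = (\<Prod>i=1..n. \<psi> i)"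
      by (subst char_distr_sum)
         (auto intro!: indep_vars_compose2[OF indep[of n, simplified]] prod.cong simp: scale)
    finally have prod: "char (distr M borel (\<lambda>\<omega>. (\<Sum>i=1..n. X n i \<omega>) / sqrt (real n))) t
      = (\<Prod>i=1..n. \<psi> i)" .
    \<comment> \<open>The target is itself a product of \<open>n\<close> factors, so the two products can be compared factorwise.\<close>
    have pow: "exp (- (t\<^sup>2 * \<sigma>\<^sup>2 / 2)) = g ^ n"
      unfolding g_def exp_of_nat_mult[symmetric] s2 using n by simp
    have "cmod ((\<Prod>i=1..n. \<psi> i) - (\<Prod>i=1..n. of_real g)) \<le> (\<Sum>i=1..n. cmod (\<psi> i - of_real g))"
      unfolding \<psi>_def g_def
      by (intro norm_prod_diff real_distribution.cmod_char_le_1 real_distribution_distr rv) auto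
    also have "\<dots> \<le> (\<Sum>i=1..n. \<bar>s\<bar> ^ 3 / 6 + s\<^sup>2 * \<bar>v n - \<sigma>\<^sup>2\<bar> / 2 + (s\<^sup>2 * \<sigma>\<^sup>2 / 2)\<^sup>2)"
      unfolding \<psi>_def g_def
      by (intro sum_mono char_approx_gauss rv) (auto simp: bound mean var)
    also have "\<dots> = real n * (\<bar>s\<bar> ^ 3 / 6 + s\<^sup>2 * \<bar>v n - \<sigma>\<^sup>2\<bar> / 2 + (s\<^sup>2 * \<sigma>\<^sup>2 / 2)\<^sup>2)" by simp
    also have "\<dots> = err n"
    proof -
      have "\<bar>s\<bar> ^ 3 = \<bar>t\<bar> ^ 3 / (real n * sqrt (real n))"
        using n by (simp add: s_def power3_eq_cube abs_divide)
      then show ?thesis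
        using n unfolding err_def s2 by (simp add: field_simps power2_eq_square)
    qed
    finally show ?thesis unfolding prod pow by (simp add: prod_constant)
  qed
  have "err \<longlonglongrightarrow> \<bar>t\<bar> ^ 3 / 6 * 0 + t\<^sup>2 / 2 * \<bar>\<sigma>\<^sup>2 - \<sigma>\<^sup>2\<bar> + (t\<^sup>2 * \<sigma>\<^sup>2 / 2)\<^sup>2 * 0"
    unfolding err_def
    by (intro tendsto_intros lim lim_1_over_n
        real_tendsto_divide_at_top[OF tendsto_const] filterlim_compose[OF sqrt_at_top]
        filterlim_real_sequentially)
  then have "err \<longlonglongrightarrow> 0" by simp
  then have "(\<lambda>n. char (distr M borel (\<lambda>\<omega>. (\<Sum>i=1..n. X n i \<omega>) / sqrt (real n))) t
      - of_real (exp (- (t\<^sup>2 * \<sigma>\<^sup>2 / 2)))) \<longlonglongrightarrow> 0"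
    by (rule Lim_null_comparison[rotated])
       (use bound_err in \<open>auto intro: eventually_sequentiallyI[of 1]\<close>)
  then show "(\<lambda>n. char (distr M borel (\<lambda>\<omega>. (\<Sum>i=1..n. X n i \<omega>) / sqrt (real n))) t)
      \<longlonglongrightarrow> char (distr std_normal_distribution borel (\<lambda>z. \<sigma> * z)) t"
    unfolding limit by (rule LIM_zero_cancel)
qed

text \<open>
  Weak convergence to a law without atoms may also be evaluated along a convergent sequence of
  points: by monotonicity, the distribution functions are trapped between their values at two fixed
  points on either side of the limit point.
\<close>

lemma weak_conv_cdf_at_convergent_points:
  assumes conv: "weak_conv_m N L" and N: "\<And>n. real_distribution (N n)" and L: "real_distribution L"
    and cont: "\<And>x. isCont (cdf L) x" and a: "a \<longlonglongrightarrow> b"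
  shows "(\<lambda>n. cdf (N n) (a n)) \<longlonglongrightarrow> cdf L b"
proof (rule tendstoI)
  fix e :: real assume e: "e > 0"
  have mono: "cdf (N n) x \<le> cdf (N n) y" if "x \<le> y" for n x y
    using N[of n] that
    by (intro finite_borel_measure.cdf_nondecreasing real_distribution.finite_borel_measure_M)
  obtain d where d: "d > 0" "\<And>x. \<bar>x - b\<bar> < d \<Longrightarrow> \<bar>cdf L x - cdf L b\<bar> < e / 2"
    using cont[of b] e unfolding continuous_at_eps_delta dist_real_def by (meson half_gt_zero)
  have near: "\<forall>\<^sub>F n in sequentially. \<bar>cdf (N n) x - cdf L x\<bar> < e / 2" for x
    using conv cont e unfolding weak_conv_m_def weak_conv_def
    by (auto dest!: tendstoD[where e = "e / 2"] simp: dist_real_def)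
  have "\<forall>\<^sub>F n in sequentially. \<bar>a n - b\<bar> < d / 2"
    using tendstoD[OF a, of "d / 2"] d(1) by (simp add: dist_real_def)
  then show "\<forall>\<^sub>F n in sequentially. dist (cdf (N n) (a n)) (cdf L b) < e"
    using near[of "b - d / 2"] near[of "b + d / 2"]
  proof eventually_elim
    case (elim n)
    have "cdf (N n) (b - d / 2) \<le> cdf (N n) (a n)" "cdf (N n) (a n) \<le> cdf (N n) (b + d / 2)"
      using elim(1) by (intro mono; linarith)+
    moreover have "\<bar>cdf L (b - d / 2) - cdf L b\<bar> < e / 2" "\<bar>cdf L (b + d / 2) - cdf L b\<bar> < e / 2"
      using d by auto
    ultimately show ?case using elim(2,3) unfolding dist_real_def by linarith
  qed
qed

lemma isCont_cdf_scaled_std_normal: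
  assumes "\<sigma> \<noteq> 0"
  shows "isCont (cdf (distr std_normal_distribution borel (\<lambda>z. \<sigma> * z))) x"
proof -
  interpret N: real_distribution std_normal_distribution by (rule real_dist_normal_dist)
  interpret L: real_distribution "distr std_normal_distribution borel (\<lambda>z. \<sigma> * z)"
    by (intro N.real_distribution_distr) simp
  have "(\<lambda>z. \<sigma> * z) -` {x} = {x / \<sigma>}" using assms by (auto simp: field_simps)
  moreover have "measure std_normal_distribution {x / \<sigma>} = 0"
    by (simp add: measure_def emeasure_density nn_integral_indicator_singleton)
  ultimately show ?thesis by (simp add: L.isCont_cdf measure_distr)
qed

section \<open>Consistency and the limit law\<close>

text \<open>
  The distribution function is below \<open>q\<close> to the left of the infimum and, being monotone, at least
  \<open>q\<close> to the right of it. If it does not jump at \<open>\<alpha>\<close>, both one-sided limits equal its value there,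
  which must then be \<open>q\<close>.
\<close>

lemma (in real_distribution) cdf_quantile:
  fixes q :: real
  assumes "0 < q" "q < 1" and \<alpha>: "\<alpha> = Inf {a. cdf M a \<ge> q}"
  shows cdf_less_quantile: "\<And>a. a < \<alpha> \<Longrightarrow> cdf M a < q"
    and cdf_eq_at_quantile: "isCont (cdf M) \<alpha> \<Longrightarrow> cdf M \<alpha> = q"
proof -
  let ?S = "{a. cdf M a \<ge> q}"
  have "\<forall>\<^sub>F a in at_bot. cdf M a < q"
    using order_tendstoD(2)[OF cdf_lim_at_bot] assms by auto
  then obtain b where b: "\<And>a. a \<le> b \<Longrightarrow> cdf M a < q"
    by (auto simp: eventually_at_bot_linorder)
  have bdd: "bdd_below ?S"
    by (rule bdd_belowI[of _ b]) (use b in \<open>force simp: not_less[symmetric]\<close>)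
  have "\<forall>\<^sub>F a in at_top. q < cdf M a"
    using order_tendstoD(1)[OF cdf_lim_at_top_prob] assms by auto
  then have ne: "?S \<noteq> {}"
    by (auto simp: eventually_at_top_linorder intro: less_imp_le)
  show below: "cdf M a < q" if "a < \<alpha>" for a
    using cInf_lower[OF _ bdd, of a] that \<alpha> by (force simp: not_le[symmetric])
  have above: "q \<le> cdf M a" if "\<alpha> < a" for a
  proof -
    have "Inf ?S < a" using that \<alpha> by simp
    from cInf_lessD[OF ne this] obtain a' where "a' \<in> ?S" "a' < a" by blast
    then show ?thesis using cdf_nondecreasing[of a' a] by auto
  qed
  assume cont: "isCont (cdf M) \<alpha>"
  show "cdf M \<alpha> = q"
  proof (rule antisym)
    have lim: "(cdf M \<longlongrightarrow> cdf M \<alpha>) (at_left \<alpha>)" "(cdf M \<longlongrightarrow> cdf M \<alpha>) (at_right \<alpha>)"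
      using cont by (auto simp: isCont_def filterlim_at_split)
    show "cdf M \<alpha> \<le> q"
      by (rule tendsto_upperbound[OF lim(1)]) (auto simp: eventually_at_filter below less_imp_le)
    show "q \<le> cdf M \<alpha>"
      by (rule tendsto_lowerbound[OF lim(2)]) (auto simp: eventually_at_filter above)
  qed
qed

lemma (in prob_space) expectation_indicator_atMost:
  fixes X :: "'a \<Rightarrow> real"
  assumes "random_variable borel X"
  shows "expectation (\<lambda>\<omega>. indicator {..u} (X \<omega>) :: real) = cdf (distr M borel X) u"
proof -
  have "expectation (\<lambda>\<omega>. indicator {..u} (X \<omega>) :: real) = (\<integral>x. indicator {..u} x \<partial>distr M borel X)"
    using assms by (intro integral_distr[symmetric]) auto
  then show ?thesis by (simp add: cdf_def)
qed

text \<open>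
  Almost sure convergence of frequencies is used at the countably many thresholds \<open>\<alpha> \<plusminus> 1 / (j + 1)\<close>
  only, so that one null set serves for all of them.
\<close>

lemma (in prob_space) alpha_DRO_consistent:
  fixes X :: "nat \<Rightarrow> 'a \<Rightarrow> real"
  assumes indep: "indep_vars (\<lambda>_. borel) X UNIV"
    and distr: "\<And>i. distr M borel (X i) = P"
    and \<delta>: "0 < \<delta>" "\<delta> < 1"
    and below: "\<And>\<eta>. \<eta> > 0 \<Longrightarrow> cdf P (\<alpha> - \<eta>) < 1 - \<delta>"
    and above: "\<And>\<eta>. \<eta> > 0 \<Longrightarrow> 1 - \<delta> < cdf P (\<alpha> + \<eta>)"
    and \<rho>: "\<rho> \<longlonglongrightarrow> 0"
  shows "AE \<omega> in M. (\<lambda>K. alpha_DRO \<delta> (\<rho> K) K (\<lambda>i. X i \<omega>)) \<longlonglongrightarrow> \<alpha>"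
proof -
  have rv[measurable]: "random_variable borel (X i)" for i
    using indep by (auto simp: indep_vars_def2)
  define freq where "freq u n \<omega> = (\<Sum>i=1..n. indicator {..u} (X i \<omega>)) / real n" for u n \<omega>
  have cdf_P: "expectation (\<lambda>\<omega>. indicator {..u} (X i \<omega>)) = cdf P u" for u i
    by (simp add: expectation_indicator_atMost distr)
  have "AE \<omega> in M. (\<lambda>n. freq u n \<omega>) \<longlonglongrightarrow> cdf P u" for u
    unfolding freq_def
  proof (rule strong_law_bounded)
    show "indep_vars (\<lambda>_. borel) (\<lambda>i \<omega>. indicator {..u} (X i \<omega>)) UNIV"
      by (intro indep_vars_compose2[OF indep]) auto
    show "indicator {..u} (X i \<omega>) \<in> {0..1::real}" for i \<omega> by (simp add: indicator_def)
  qed (rule cdf_P)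
  then have "AE \<omega> in M. \<forall>j. (\<lambda>n. freq (\<alpha> - 1 / real (Suc j)) n \<omega>) \<longlonglongrightarrow> cdf P (\<alpha> - 1 / real (Suc j)) \<and>
      (\<lambda>n. freq (\<alpha> + 1 / real (Suc j)) n \<omega>) \<longlonglongrightarrow> cdf P (\<alpha> + 1 / real (Suc j))"
    unfolding AE_all_countable by (intro allI AE_conjI)
  then show ?thesis
  proof eventually_elim
    case (elim \<omega>)
    let ?q = "\<lambda>K. alpha_DRO \<delta> 0 K (\<lambda>i. X i \<omega>)"
    have q_le: "?q K \<le> u \<longleftrightarrow> 1 - \<delta> \<le> freq u K \<omega>" if "K \<ge> 1" for K u
      using alpha_DRO_le_iff_sum[OF \<delta> that] that by (simp add: freq_def field_simps)
    have "?q \<longlonglongrightarrow> \<alpha>"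
    proof (rule tendstoI)
      fix e :: real assume "e > 0"
      then obtain j where j: "1 / real (Suc j) < e" using nat_approx_posE by blast
      define \<eta> where "\<eta> = 1 / real (Suc j)"
      have \<eta>: "\<eta> > 0" "\<eta> < e" using j by (auto simp: \<eta>_def)
      have "\<forall>\<^sub>F K in sequentially. freq (\<alpha> - \<eta>) K \<omega> < 1 - \<delta>"
        using elim[rule_format, of j] below[OF \<eta>(1)] by (auto simp: \<eta>_def dest: order_tendstoD(2))
      moreover have "\<forall>\<^sub>F K in sequentially. 1 - \<delta> < freq (\<alpha> + \<eta>) K \<omega>"
        using elim[rule_format, of j] above[OF \<eta>(1)] by (auto simp: \<eta>_def dest: order_tendstoD(1))
      ultimately show "\<forall>\<^sub>F K in sequentially. dist (?q K) \<alpha> < e"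
        using eventually_ge_at_top[of 1]
      proof eventually_elim
        case (elim K)
        then have "\<not> ?q K \<le> \<alpha> - \<eta>" "?q K \<le> \<alpha> + \<eta>" by (simp_all add: q_le)
        then show ?case using \<eta> by (simp add: dist_real_def)
      qed
    qed
    from tendsto_add[OF this \<rho>] show ?case by (simp flip: alpha_DRO_shift)
  qed
qed

text \<open>
  The threshold \<open>u\<close> below depends on \<open>K\<close>, and so does the success probability \<open>cdf P u\<close>; its
  convergence to \<open>1 - \<delta>\<close> provides the variance \<open>\<delta> (1 - \<delta>)\<close> of the limit.
\<close>

lemma (in prob_space) alpha_DRO_limit_law:
  fixes X :: "nat \<Rightarrow> 'a \<Rightarrow> real"
  assumes indep: "indep_vars (\<lambda>_. borel) X UNIV"
    and distr: "\<And>i. distr M borel (X i) = P"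
    and \<delta>: "0 < \<delta>" "\<delta> < 1"
    and deriv: "(cdf P has_real_derivative f) (at \<alpha>)" and f: "f > 0"
    and cdf_\<alpha>: "cdf P \<alpha> = 1 - \<delta>"
    and \<rho>: "(\<lambda>K. sqrt (real K) * \<rho> K) \<longlonglongrightarrow> c"
  shows "weak_conv_m
    (\<lambda>K. distr M borel (\<lambda>\<omega>. sqrt (real K) * (alpha_DRO \<delta> (\<rho> K) K (\<lambda>i. X i \<omega>) - \<alpha>)))
    (distr std_normal_distribution borel (\<lambda>z. sqrt (\<delta> * (1 - \<delta>)) / f * z + c))"
  unfolding weak_conv_m_def weak_conv_def
proof (intro allI impI)
  fix z :: real
  define \<sigma> where "\<sigma> = sqrt (\<delta> * (1 - \<delta>))"
  have \<sigma>: "\<sigma> > 0" "\<sigma>\<^sup>2 = \<delta> * (1 - \<delta>)" using \<delta> by (auto simp: \<sigma>_def)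
  have rv[measurable]: "random_variable borel (X i)" for i
    using indep by (auto simp: indep_vars_def2)
  interpret N: real_distribution std_normal_distribution by (rule real_dist_normal_dist)
  define u where "u K = \<alpha> + z / sqrt (real K) - \<rho> K" for K
  define p where "p K = cdf P (u K)" for K
  define Y where "Y K i \<omega> = p K - indicator {..u K} (X i \<omega>)" for K i \<omega>
  define b where "b K = sqrt (real K) * (p K - (1 - \<delta>))" for K
  have Y_rv[measurable]: "random_variable borel (Y K i)" for K i
    unfolding Y_def by measurable
  have p01: "0 \<le> p K" "p K \<le> 1" for K
  proof -
    interpret P: real_distribution P
      using real_distribution_distr[OF rv, of 0] by (simp add: distr)
    show "0 \<le> p K" "p K \<le> 1"
      unfolding p_def by (rule P.cdf_nonneg, rule P.cdf_bounded_prob)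
  qed
  have exp_ind: "expectation (\<lambda>\<omega>. indicator {..u K} (X i \<omega>)) = p K" for K i
    by (simp add: expectation_indicator_atMost distr p_def)
  have int_ind: "integrable M (\<lambda>\<omega>. indicator {..u K} (X i \<omega>) :: real)" for K i
    by (intro integrable_const_bound[where B = 1] AE_I2) (auto simp: indicator_def)
  have mean: "expectation (Y K i) = 0" for K i
    unfolding Y_def using int_ind by (simp add: exp_ind prob_space)
  have var: "expectation (\<lambda>\<omega>. (Y K i \<omega>)\<^sup>2) = p K * (1 - p K)" for K i
  proof -
    have "expectation (\<lambda>\<omega>. (Y K i \<omega>)\<^sup>2)
        = expectation (\<lambda>\<omega>. (p K)\<^sup>2 + (1 - 2 * p K) * indicator {..u K} (X i \<omega>))"
      by (intro Bochner_Integration.integral_cong)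
         (auto simp: Y_def indicator_def power2_eq_square algebra_simps)
    also have "\<dots> = (p K)\<^sup>2 + (1 - 2 * p K) * p K"
      using int_ind by (simp add: exp_ind prob_space)
    finally show ?thesis by (simp add: power2_eq_square algebra_simps)
  qed

  \<comment> \<open>\<open>g\<close> is the difference quotient of the distribution function at \<open>\<alpha>\<close>, continuously extended.
    It multiplies the scaled distance \<open>sqrt K * (u K - \<alpha>)\<close>, which converges.\<close>
  obtain g where g: "\<And>x. cdf P x - cdf P \<alpha> = g x * (x - \<alpha>)" "isCont g \<alpha>" "g \<alpha> = f"
    using deriv unfolding CARAT_DERIV by blast
  have inv: "(\<lambda>K. 1 / sqrt (real K)) \<longlonglongrightarrow> 0"
    by (intro real_tendsto_divide_at_top[OF tendsto_const] filterlim_compose[OF sqrt_at_top]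
        filterlim_real_sequentially)
  have drift: "(\<lambda>K. sqrt (real K) * (u K - \<alpha>)) \<longlonglongrightarrow> z - c"
  proof (rule Lim_transform_eventually)
    show "(\<lambda>K. z - sqrt (real K) * \<rho> K) \<longlonglongrightarrow> z - c" by (intro tendsto_intros \<rho>)
    show "\<forall>\<^sub>F K in sequentially. z - sqrt (real K) * \<rho> K = sqrt (real K) * (u K - \<alpha>)"
      by (rule eventually_sequentiallyI[of 1]) (simp add: u_def algebra_simps)
  qed
  have u_lim: "u \<longlonglongrightarrow> \<alpha>"
  proof (rule Lim_transform_eventually)
    have "(\<lambda>K. \<alpha> + (1 / sqrt (real K)) * (sqrt (real K) * (u K - \<alpha>))) \<longlonglongrightarrow> \<alpha> + 0 * (z - c)"
      by (intro tendsto_intros inv drift)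
    then show "(\<lambda>K. \<alpha> + (1 / sqrt (real K)) * (sqrt (real K) * (u K - \<alpha>))) \<longlonglongrightarrow> \<alpha>" by simp
    show "\<forall>\<^sub>F K in sequentially. \<alpha> + (1 / sqrt (real K)) * (sqrt (real K) * (u K - \<alpha>)) = u K"
      by (rule eventually_sequentiallyI[of 1]) simp
  qed
  have p_lim: "p \<longlonglongrightarrow> 1 - \<delta>"
    unfolding p_def cdf_\<alpha>[symmetric] by (rule isCont_tendsto_compose[OF DERIV_isCont[OF deriv] u_lim])
  have "b = (\<lambda>K. g (u K) * (sqrt (real K) * (u K - \<alpha>)))"
    using g(1) by (auto simp: b_def p_def fun_eq_iff simp flip: cdf_\<alpha>)
  then have b_lim: "b \<longlonglongrightarrow> f * (z - c)"
    using isCont_tendsto_compose[OF g(2) u_lim] by (simp add: g(3) tendsto_mult drift)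

  define G where "G = distr std_normal_distribution borel (\<lambda>z. \<sigma> * z)"
  define S where "S K = distr M borel (\<lambda>\<omega>. (\<Sum>i=1..K. Y K i \<omega>) / sqrt (real K))" for K
  have S_cdf: "cdf (S K) y = prob {\<omega> \<in> space M. (\<Sum>i=1..K. Y K i \<omega>) / sqrt (real K) \<le> y}" for K y
    unfolding S_def cdf_def by (subst measure_distr) (auto simp: vimage_def Int_def conj_commute)
  have "weak_conv_m S G"
    unfolding S_def G_def
  proof (rule clt_bounded_array)
    show "indep_vars (\<lambda>_. borel) (Y K) {1..K}" for K
      unfolding Y_def by (intro indep_vars_compose2[OF indep_vars_subset[OF indep]]) auto
    show "\<bar>Y K i \<omega>\<bar> \<le> 1" for K i \<omega>
      using p01[of K] by (auto simp: Y_def indicator_def)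
    have "(\<lambda>K. p K * (1 - p K)) \<longlonglongrightarrow> (1 - \<delta>) * (1 - (1 - \<delta>))" by (intro tendsto_intros p_lim)
    then show "(\<lambda>K. p K * (1 - p K)) \<longlonglongrightarrow> \<sigma>\<^sup>2" by (simp add: \<sigma> mult.commute)
  qed (simp_all add: mean var)
  then have "(\<lambda>K. cdf (S K) (b K)) \<longlonglongrightarrow> cdf G (f * (z - c))"
  proof (rule weak_conv_cdf_at_convergent_points[OF _ _ _ _ b_lim])
    show "real_distribution (S K)" for K
      unfolding S_def by (intro real_distribution_distr) measurable
    show "real_distribution G" unfolding G_def by (intro N.real_distribution_distr) simp
    show "isCont (cdf G) x" for x
      unfolding G_def using \<sigma>(1) by (intro isCont_cdf_scaled_std_normal) simp
  qed
  also have "cdf G (f * (z - c)) = cdf (distr std_normal_distribution borel (\<lambda>z. \<sigma> / f * z + c)) z"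
  proof -
    have "(\<lambda>z. \<sigma> * z) -` {..f * (z - c)} = (\<lambda>z. \<sigma> / f * z + c) -` {..z}"
      using f by (auto simp: field_simps)
    then show ?thesis unfolding G_def cdf_def by (simp add: measure_distr)
  qed
  finally have lim: "(\<lambda>K. cdf (S K) (b K))
    \<longlonglongrightarrow> cdf (distr std_normal_distribution borel (\<lambda>z. \<sigma> / f * z + c)) z" .
  have "cdf (S K) (b K) = cdf (distr M borel
      (\<lambda>\<omega>. sqrt (real K) * (alpha_DRO \<delta> (\<rho> K) K (\<lambda>i. X i \<omega>) - \<alpha>))) z" if K: "K \<ge> 1" for K
  proof -
    have "alpha_DRO \<delta> (\<rho> K) K (\<lambda>i. X i \<omega>) \<le> t \<longleftrightarrow>
        real K * (1 - \<delta>) \<le> (\<Sum>i=1..K. indicator {..t - \<rho> K} (X i \<omega>))" for t \<omega>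
      by (rule alpha_DRO_le_iff_sum[OF \<delta> K])
    then have [measurable]: "random_variable borel (\<lambda>\<omega>. alpha_DRO \<delta> (\<rho> K) K (\<lambda>i. X i \<omega>))"
      unfolding borel_measurable_iff_le by simp
    have "sqrt (real K) * (alpha_DRO \<delta> (\<rho> K) K (\<lambda>i. X i \<omega>) - \<alpha>) \<le> z \<longleftrightarrow>
        (\<Sum>i=1..K. Y K i \<omega>) / sqrt (real K) \<le> b K" for \<omega>
    proof -
      have "sqrt (real K) * (alpha_DRO \<delta> (\<rho> K) K (\<lambda>i. X i \<omega>) - \<alpha>) \<le> z \<longleftrightarrow>
          alpha_DRO \<delta> (\<rho> K) K (\<lambda>i. X i \<omega>) \<le> \<alpha> + z / sqrt (real K)"
        using K by (simp add: field_simps)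
      also have "\<dots> \<longleftrightarrow> real K * (1 - \<delta>) \<le> (\<Sum>i=1..K. indicator {..u K} (X i \<omega>))"
        unfolding alpha_DRO_le_iff_sum[OF \<delta> K] u_def ..
      also have "\<dots> \<longleftrightarrow> (\<Sum>i=1..K. Y K i \<omega>) \<le> real K * (p K - (1 - \<delta>))"
        by (auto simp: Y_def sum_subtractf algebra_simps)
      also have "real K * (p K - (1 - \<delta>)) = b K * sqrt (real K)"
        by (simp add: b_def)
      also have "(\<Sum>i=1..K. Y K i \<omega>) \<le> b K * sqrt (real K) \<longleftrightarrow>
          (\<Sum>i=1..K. Y K i \<omega>) / sqrt (real K) \<le> b K"
        using K by (intro pos_divide_le_eq[symmetric]) simp
      finally show ?thesis .
    qed
    then show ?thesis
      unfolding S_cdf unfolding cdf_def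
      by (subst measure_distr) (auto simp: vimage_def Int_def conj_commute)
  qed
  then have "\<forall>\<^sub>F K in sequentially. cdf (S K) (b K) = cdf (distr M borel
      (\<lambda>\<omega>. sqrt (real K) * (alpha_DRO \<delta> (\<rho> K) K (\<lambda>i. X i \<omega>) - \<alpha>))) z"
    by (intro eventually_sequentiallyI[of 1])
  from Lim_transform_eventually[OF lim this]
  show "(\<lambda>K. cdf (distr M borel
      (\<lambda>\<omega>. sqrt (real K) * (alpha_DRO \<delta> (\<rho> K) K (\<lambda>i. X i \<omega>) - \<alpha>))) z)
    \<longlonglongrightarrow> cdf (distr std_normal_distribution borel (\<lambda>z. sqrt (\<delta> * (1 - \<delta>)) / f * z + c)) z"
    unfolding \<sigma>_def .
qed

theorem lemma4p11:
  fixes M :: "'a measure" and R :: "nat \<Rightarrow> 'a \<Rightarrow> real" and P :: "real measure"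
    and F :: "real \<Rightarrow> real" and \<delta> \<beta> \<alpha> :: real and r :: "nat \<Rightarrow> real \<Rightarrow> real"
  assumes "0 < \<delta>" and "\<delta> < 1" and "0 < \<beta>" and "\<beta> < 1"
    and "prob_space M"
    and indep: "prob_space.indep_vars M (\<lambda>_. borel) R UNIV"
    and ident: "\<And>i. distr M borel (R i) = P"
    and F: "F = cdf P"
    and radius_pos: "\<And>K. K \<ge> 1 \<Longrightarrow> r K \<beta> > 0"
    and radius: "\<And>K. K \<ge> 1 \<Longrightarrow>
      measure (sample_measure K P)
        {x \<in> space (sample_measure K P). W_inf (empirical_measure K x) P \<le> ennreal (r K \<beta>)} \<ge> 1 - \<beta>"
    and \<alpha>: "\<alpha> = Inf {a. F a \<ge> 1 - \<delta>}"
    and nbhd: "\<exists>\<epsilon>>0. continuous_on {\<alpha>-\<epsilon><..<\<alpha>+\<epsilon>} F \<and> strict_mono_on {\<alpha>-\<epsilon><..<\<alpha>+\<epsilon>} F"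
    and radius_lim: "(\<lambda>K. r K \<beta>) \<longlonglongrightarrow> 0"
  shows
    "(AE \<omega> in M. (\<lambda>K. alpha_DRO \<delta> (r K \<beta>) K (\<lambda>i. R i \<omega>)) \<longlonglongrightarrow> \<alpha>)
     \<and> (\<forall>K\<ge>1. \<forall>t. let u = t - r K \<beta>; m_DRO = nat \<lceil>real K * (1 - \<delta>)\<rceil> in
          measure (sample_measure K P)
            {x \<in> space (sample_measure K P). alpha_DRO \<delta> (r K \<beta>) K x \<le> t}
          = (\<Sum>i = m_DRO..K. real (K choose i) * F u ^ i * (1 - F u) ^ (K - i)))
     \<and> (\<forall>f c. (F has_real_derivative f) (at \<alpha>) \<and> f > 0
            \<and> c \<ge> 0 \<and> (\<lambda>K. sqrt (real K) * r K \<beta>) \<longlonglongrightarrow> c \<longrightarrow>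
          weak_conv_m
            (\<lambda>K. distr M borel
               (\<lambda>\<omega>. sqrt (real K) * (alpha_DRO \<delta> (r K \<beta>) K (\<lambda>i. R i \<omega>) - \<alpha>)))
            (distr std_normal_distribution borel (\<lambda>z. sqrt (\<delta> * (1 - \<delta>)) / f * z + c)))
     \<and> (\<forall>m>0. \<exists>c\<ge>0.
          (\<lambda>K. sqrt (real K) * (1 / m * sqrt (ln (2 / \<beta>) / (2 * real K)))) \<longlonglongrightarrow> c)"
proof -
  interpret prob_space M by fact
  note \<delta> = \<open>0 < \<delta>\<close> \<open>\<delta> < 1\<close>
  have rv: "random_variable borel (R i)" for i
    using indep by (auto simp: indep_vars_def2)
  interpret P: real_distribution P
    using real_distribution_distr[OF rv, of 0] by (simp add: ident)
  have \<alpha>': "\<alpha> = Inf {a. cdf P a \<ge> 1 - \<delta>}" using \<alpha> F by simp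
  obtain \<epsilon> where \<epsilon>: "\<epsilon> > 0" "continuous_on {\<alpha>-\<epsilon><..<\<alpha>+\<epsilon>} (cdf P)"
    "strict_mono_on {\<alpha>-\<epsilon><..<\<alpha>+\<epsilon>} (cdf P)"
    using nbhd F by blast
  have "isCont (cdf P) \<alpha>"
    using \<epsilon> by (intro continuous_on_interior[OF \<epsilon>(2)]) auto
  then have cdf_\<alpha>: "cdf P \<alpha> = 1 - \<delta>"
    using \<delta> by (intro P.cdf_eq_at_quantile[OF _ _ \<alpha>']) auto
  have below: "cdf P (\<alpha> - \<eta>) < 1 - \<delta>" if "\<eta> > 0" for \<eta>
    using \<delta> that by (intro P.cdf_less_quantile[OF _ _ \<alpha>']) auto
  \<comment> \<open>\<open>F\<close> increases strictly only near \<open>\<alpha>\<close>; monotonicity carries the strict bound further out.\<close>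
  have above: "1 - \<delta> < cdf P (\<alpha> + \<eta>)" if "\<eta> > 0" for \<eta>
  proof -
    have "cdf P \<alpha> < cdf P (\<alpha> + min \<eta> (\<epsilon> / 2))"
      using \<epsilon>(1) that by (intro strict_mono_onD[OF \<epsilon>(3)]) auto
    also have "\<dots> \<le> cdf P (\<alpha> + \<eta>)" by (intro P.cdf_nondecreasing) simp
    finally show ?thesis using cdf_\<alpha> by simp
  qed
  show ?thesis
  proof (intro conjI allI impI)
    show "AE \<omega> in M. (\<lambda>K. alpha_DRO \<delta> (r K \<beta>) K (\<lambda>i. R i \<omega>)) \<longlonglongrightarrow> \<alpha>"
      by (rule alpha_DRO_consistent[OF indep ident \<delta> below above radius_lim])
  next
    fix K :: nat and t :: real
    assume K: "K \<ge> 1"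
    show "let u = t - r K \<beta>; m_DRO = nat \<lceil>real K * (1 - \<delta>)\<rceil> in
        measure (sample_measure K P)
          {x \<in> space (sample_measure K P). alpha_DRO \<delta> (r K \<beta>) K x \<le> t}
        = (\<Sum>i = m_DRO..K. real (K choose i) * F u ^ i * (1 - F u) ^ (K - i))"
      using measure_PiM_card_ge[of P "{1..K}" "{..t - r K \<beta>}" "nat \<lceil>real K * (1 - \<delta>)\<rceil>"]
        P.prob_space_axioms
      by (simp add: Let_def sample_measure_def alpha_DRO_le_iff_card[OF \<delta> K] F cdf_def)
  next
    fix f c :: real
    assume "(F has_real_derivative f) (at \<alpha>) \<and> f > 0
      \<and> c \<ge> 0 \<and> (\<lambda>K. sqrt (real K) * r K \<beta>) \<longlonglongrightarrow> c"
    then show "weak_conv_m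
        (\<lambda>K. distr M borel
           (\<lambda>\<omega>. sqrt (real K) * (alpha_DRO \<delta> (r K \<beta>) K (\<lambda>i. R i \<omega>) - \<alpha>)))
        (distr std_normal_distribution borel (\<lambda>z. sqrt (\<delta> * (1 - \<delta>)) / f * z + c))"
      unfolding F by (intro alpha_DRO_limit_law[OF indep ident \<delta> _ _ cdf_\<alpha>]) auto
  next
    fix m :: real assume m: "m > 0"
    let ?c = "1 / m * sqrt (ln (2 / \<beta>) / 2)"
    have "ln (2 / \<beta>) \<ge> 0" using \<open>0 < \<beta>\<close> \<open>\<beta> < 1\<close> by simp
    then have "?c \<ge> 0" using m by simp
    moreover have "(\<lambda>K. sqrt (real K) * (1 / m * sqrt (ln (2 / \<beta>) / (2 * real K)))) \<longlonglongrightarrow> ?c"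
    proof (rule tendsto_eventually, rule eventually_sequentiallyI[of 1])
      fix K :: nat assume "K \<ge> 1"
      then show "sqrt (real K) * (1 / m * sqrt (ln (2 / \<beta>) / (2 * real K))) = ?c"
        by (simp add: real_sqrt_divide real_sqrt_mult)
    qed
    ultimately show "\<exists>c\<ge>0. (\<lambda>K. sqrt (real K) * (1 / m * sqrt (ln (2 / \<beta>) / (2 * real K)))) \<longlonglongrightarrow> c"
      by blast
  qed
qed

end
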